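(* Every weakly orthocomplete Archimedean atomic effect algebra is orthoatomistic.
   Context: An effect algebra is an algebraic structure $(E,\oplus,\mathbf{0},\mathbf{1})$ where $E$ is a set, $\mathbf{0}\neq\mathbf{1}$ are elements of $E$, and $\oplus$ is a partial binary operation on $E$ such that for all $a,b,c\in E$: (1) $a\oplus b=b\oplus a$ if $a\oplus b$ exists (in particular $b\oplus a$ then exists); (2) $(a\oplus b)\oplus c=a\oplus(b\oplus c)$ if $(a\oplus b)\oplus c$ exists (in particular the right-hand side then exists); (3) there is a unique $a'\in E$ such that $a\oplus a'=\mathbf{1}$; (4) $a=\mathbf{0}$ whenever $a\oplus\mathbf{1}$ is defined. The partial order on $E$ is defined by $a\le b$ iff there is $c\in E$ with $b=a\oplus c$; $\mathbf{0}$ is the least and $\mathbf{1}$ the greatest element. Suprema and (minimal) upper bounds are taken with respect to this order. Finite sums $\bigoplus_{i\in F}a_i$ are iterated $\oplus$-sums (when defined), the empty sum being $\mathbf{0}$. The isotropic index of $a\in E$ is $\sup\{n\in\mathbb{N} : na \text{ is defined}\}$, where $na$ is the $\oplus$-sum of $n$ copies of $a$. $E$ is Archimedean if every nonzero element has a finite isotropic index. A system $(a_i)_{i\in I}$ of (not necessarily distinct) elements of $E$ is orthogonal if $\bigoplus_{i\in F}a_i$ is defined for every finite $F\subset I$. For an orthogonal system, $\bigoplus_{i\in I}a_i$ is defined as the supremum $\bigvee\{\bigoplus_{i\in F}a_i : F\subset I \text{ finite}\}$ if this supremum exists. $E$ is weakly orthocomplete if for every orthogonal system $(a_i)_{i\in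 I}$ of elements of $E$ either $\bigoplus_{i\in I}a_i$ exists or the set $\{\bigoplus_{i\in F}a_i : F\subset I \text{ finite}\}$ has no minimal upper bound in $E$. An atom of $E$ is a minimal element of $E\setminus\{\mathbf{0}\}$. $E$ is atomic if for every nonzero $a\in E$ there is an atom less than or equal to $a$. $E$ is orthoatomistic if every nonzero $a\in E$ is a sum of atoms, i.e. $a=\bigoplus_{i\in I}a_i$ for some orthogonal system $(a_i)_{i\in I}$ of (not necessarily distinct) atoms of $E$. *)

theory Defs
  imports Main "HOL-Library.Extended_Nat"
begin

text \<open>The partial operation returns \<^const>\<open>None\<close> where it is undefined; its values
  on arguments outside the carrier are irrelevant.\<close>

record 'a effect_structure =
  carrier :: "'a set"
  oplus :: "'a \<Rightarrow> 'a \<Rightarrow> 'a option"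
  bottom :: 'a
  unit :: 'a

locale effect_algebra =
  fixes E :: "'a effect_structure"
  assumes bottom_closed: "bottom E \<in> carrier E"
    and unit_closed: "unit E \<in> carrier E"
    and bottom_neq_unit: "bottom E \<noteq> unit E"
    and oplus_closed:
      "\<lbrakk>a \<in> carrier E; b \<in> carrier E; oplus E a b = Some c\<rbrakk> \<Longrightarrow> c \<in> carrier E"
    and oplus_comm:
      "\<lbrakk>a \<in> carrier E; b \<in> carrier E; oplus E a b = Some c\<rbrakk> \<Longrightarrow> oplus E b a = Some c"
    and oplus_assoc:
      "\<lbrakk>a \<in> carrier E; b \<in> carrier E; c \<in> carrier E; oplus E a b = Some d; oplus E d c = Some e\<rbrakk>
        \<Longrightarrow> \<exists>f. oplus E b c = Some f \<and> oplus E a f = Some e"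
    and orthosupplement:
      "a \<in> carrier E \<Longrightarrow> \<exists>!a'. a' \<in> carrier E \<and> oplus E a a' = Some (unit E)"
    and zero_one_law:
      "\<lbrakk>a \<in> carrier E; oplus E a (unit E) \<noteq> None\<rbrakk> \<Longrightarrow> a = bottom E"

definition ea_le :: "'a effect_structure \<Rightarrow> 'a \<Rightarrow> 'a \<Rightarrow> bool" where
  "ea_le E a b \<longleftrightarrow> (\<exists>c\<in>carrier E. oplus E a c = Some b)"

definition is_upper_bound :: "'a effect_structure \<Rightarrow> 'a set \<Rightarrow> 'a \<Rightarrow> bool" where
  "is_upper_bound E S u \<longleftrightarrow> u \<in> carrier E \<and> (\<forall>s\<in>S. ea_le E s u)"

definition is_supremum :: "'a effect_structure \<Rightarrow> 'a set \<Rightarrow> 'a \<Rightarrow> bool" where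
  "is_supremum E S u \<longleftrightarrow>
     is_upper_bound E S u \<and> (\<forall>v. is_upper_bound E S v \<longrightarrow> ea_le E u v)"

definition is_minimal_upper_bound :: "'a effect_structure \<Rightarrow> 'a set \<Rightarrow> 'a \<Rightarrow> bool" where
  "is_minimal_upper_bound E S u \<longleftrightarrow>
     is_upper_bound E S u \<and> (\<forall>v. is_upper_bound E S v \<and> ea_le E v u \<longrightarrow> v = u)"

text \<open>\<open>has_finite_sum E a F s\<close>: the sum of the \<open>a i\<close> over the finite set \<open>F\<close> is defined and
  equal to \<open>s\<close>. In an effect algebra neither definedness nor the value depends on the order
  in which the indices are inserted.\<close>

inductive has_finite_sum :: "'a effect_structure \<Rightarrow> ('i \<Rightarrow> 'a) \<Rightarrow> 'i set \<Rightarrow> 'a \<Rightarrow> bool"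
  for E a where
  empty: "has_finite_sum E a {} (bottom E)"
| insert: "\<lbrakk>has_finite_sum E a F s; i \<notin> F; oplus E s (a i) = Some t\<rbrakk>
    \<Longrightarrow> has_finite_sum E a (insert i F) t"

primrec multiple :: "'a effect_structure \<Rightarrow> nat \<Rightarrow> 'a \<Rightarrow> 'a option" where
  "multiple E 0 a = Some (bottom E)"
| "multiple E (Suc n) a = Option.bind (multiple E n a) (\<lambda>s. oplus E s a)"

definition isotropic_index :: "'a effect_structure \<Rightarrow> 'a \<Rightarrow> enat" where
  "isotropic_index E a = (SUP n\<in>{n. multiple E n a \<noteq> None}. enat n)"

definition archimedean :: "'a effect_structure \<Rightarrow> bool" where
  "archimedean E \<longleftrightarrow> (\<forall>a\<in>carrier E. a \<noteq> bottom E \<longrightarrow> isotropic_index E a < \<infinity>)"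

definition orthogonal_system :: "'a effect_structure \<Rightarrow> 'i set \<Rightarrow> ('i \<Rightarrow> 'a) \<Rightarrow> bool" where
  "orthogonal_system E I a \<longleftrightarrow>
     (\<forall>i\<in>I. a i \<in> carrier E) \<and> (\<forall>F. finite F \<and> F \<subseteq> I \<longrightarrow> (\<exists>s. has_finite_sum E a F s))"

definition finite_sums :: "'a effect_structure \<Rightarrow> 'i set \<Rightarrow> ('i \<Rightarrow> 'a) \<Rightarrow> 'a set" where
  "finite_sums E I a = {s. \<exists>F. finite F \<and> F \<subseteq> I \<and> has_finite_sum E a F s}"

definition has_orthosum :: "'a effect_structure \<Rightarrow> 'i set \<Rightarrow> ('i \<Rightarrow> 'a) \<Rightarrow> 'a \<Rightarrow> bool" where
  "has_orthosum E I a s \<longleftrightarrow> orthogonal_system E I a \<and> is_supremum E (finite_sums E I a) s"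

definition is_atom :: "'a effect_structure \<Rightarrow> 'a \<Rightarrow> bool" where
  "is_atom E p \<longleftrightarrow> p \<in> carrier E \<and> p \<noteq> bottom E \<and>
     (\<forall>x\<in>carrier E. x \<noteq> bottom E \<and> ea_le E x p \<longrightarrow> x = p)"

definition atomic :: "'a effect_structure \<Rightarrow> bool" where
  "atomic E \<longleftrightarrow> (\<forall>a\<in>carrier E. a \<noteq> bottom E \<longrightarrow> (\<exists>p. is_atom E p \<and> ea_le E p a))"

text \<open>A definition cannot quantify over all index types, so systems are indexed by subsets of
  \<^typ>\<open>'a \<times> nat\<close>. This loses no generality: finite sums see an infinitely repeated element
  only through finite numbers of copies, so every system over any index type has the same
  finite sums as one indexed by a subset of \<^typ>\<open>'a \<times> nat\<close>. The lemmas
  \<open>weakly_orthocomplete_any_index\<close> and \<open>orthoatomistic_any_index\<close> below establish this.\<close>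

definition weakly_orthocomplete :: "'a effect_structure \<Rightarrow> bool" where
  "weakly_orthocomplete E \<longleftrightarrow>
     (\<forall>(I :: ('a \<times> nat) set) a. orthogonal_system E I a \<longrightarrow>
        (\<exists>s. has_orthosum E I a s) \<or>
        \<not> (\<exists>u. is_minimal_upper_bound E (finite_sums E I a) u))"

definition orthoatomistic :: "'a effect_structure \<Rightarrow> bool" where
  "orthoatomistic E \<longleftrightarrow>
     (\<forall>x\<in>carrier E. x \<noteq> bottom E \<longrightarrow>
        (\<exists>(I :: ('a \<times> nat) set) a. (\<forall>i\<in>I. is_atom E (a i)) \<and> has_orthosum E I a x))"


lemma has_finite_sum_reindex:
  assumes "has_finite_sum E a F s" "inj_on f F" "\<And>i. i \<in> F \<Longrightarrow> b (f i) = a i"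
  shows "has_finite_sum E b (f ` F) s"
  using assms
proof (induction rule: has_finite_sum.induct)
  case empty
  show ?case by (simp add: has_finite_sum.empty)
next
  case (insert F s i t)
  have "has_finite_sum E b (f ` F) s" "f i \<notin> f ` F"
    using insert by auto
  then have "has_finite_sum E b (insert (f i) (f ` F)) t"
    using insert by (intro has_finite_sum.insert[of E b "f ` F" s]) auto
  then show ?case by simp
qed

lemma has_finite_sum_reindex_iff:
  assumes "inj_on f F" "\<And>i. i \<in> F \<Longrightarrow> b (f i) = a i"
  shows "has_finite_sum E b (f ` F) s \<longleftrightarrow> has_finite_sum E a F s"
proof
  assume sum: "has_finite_sum E b (f ` F) s"
  have "has_finite_sum E a (inv_into F f ` f ` F) s"
  proof (rule has_finite_sum_reindex[OF sum])
    show "inj_on (inv_into F f) (f ` F)" by (simp add: inj_on_inv_into)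
    show "a (inv_into F f j) = b j" if "j \<in> f ` F" for j
      using that assms by (auto simp: inv_into_f_f)
  qed
  then show "has_finite_sum E a F s"
    using assms(1) by simp
next
  assume sum: "has_finite_sum E a F s"
  show "has_finite_sum E b (f ` F) s"
    by (rule has_finite_sum_reindex[OF sum assms])
qed

lemma fibrewise_injection:
  assumes "finite F" "F \<subseteq> I"
    and fib: "\<And>x A. \<lbrakk>finite A; A \<subseteq> {i \<in> I. a i = x}\<rbrakk>
      \<Longrightarrow> \<exists>g. inj_on g A \<and> g ` A \<subseteq> {j \<in> J. b j = x}"
  shows "\<exists>f. inj_on f F \<and> f ` F \<subseteq> J \<and> (\<forall>i\<in>F. b (f i) = a i)"
proof -
  have ex: "\<exists>g. inj_on g {i \<in> F. a i = x} \<and> g ` {i \<in> F. a i = x} \<subseteq> {j \<in> J. b j = x}" for x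
    by (rule fib) (use assms(1,2) in auto)
  define g where
    "g x = (SOME g. inj_on g {i \<in> F. a i = x} \<and> g ` {i \<in> F. a i = x} \<subseteq> {j \<in> J. b j = x})" for x
  have g: "inj_on (g x) {i \<in> F. a i = x}" "g x ` {i \<in> F. a i = x} \<subseteq> {j \<in> J. b j = x}" for x
    using someI_ex[OF ex[of x]] unfolding g_def by (rule conjunct1, rule conjunct2)
  have mem: "g (a i) i \<in> J" "b (g (a i) i) = a i" if "i \<in> F" for i
    using g(2)[of "a i"] that by auto
  have "inj_on (\<lambda>i. g (a i) i) F"
  proof (rule inj_onI)
    fix i j assume ij: "i \<in> F" "j \<in> F" "g (a i) i = g (a j) j"
    have "a i = b (g (a i) i)" using mem(2)[OF ij(1)] by (rule sym)
    also have "\<dots> = a j" unfolding ij(3) by (rule mem(2)[OF ij(2)])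
    finally have a: "a i = a j" .
    show "i = j"
    proof (rule inj_onD[OF g(1)[of "a i"]])
      show "g (a i) i = g (a i) j" using ij(3) unfolding a .
    qed (use ij(1,2) a in simp_all)
  qed
  moreover have "(\<lambda>i. g (a i) i) ` F \<subseteq> J" using mem(1) by (rule image_subsetI)
  moreover have "\<forall>i\<in>F. b (g (a i) i) = a i" using mem(2) by (rule ballI)
  ultimately show ?thesis by (intro exI[of _ "\<lambda>i. g (a i) i"] conjI)
qed

lemma finite_subset_injection:
  assumes "finite A" "A \<subseteq> C" "finite D \<Longrightarrow> finite C \<and> card C \<le> card D"
  shows "\<exists>g. inj_on g A \<and> g ` A \<subseteq> D"
proof (cases "finite D")
  case True
  then have "card A \<le> card D" using assms(2,3) card_mono[of C A] le_trans by blast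
  then show ?thesis using card_le_inj[OF assms(1) True] by blast
next
  case False
  then obtain B where B: "finite B" "card B = card A" "B \<subseteq> D"
    using infinite_arbitrarily_large by blast
  then show ?thesis using card_le_inj[OF assms(1) B(1)] by fastforce
qed

lemma exists_system_same_finite_sums:
  fixes I :: "'i set" and a :: "'i \<Rightarrow> 'a"
  shows "\<exists>(J :: ('a \<times> nat) set) b. b ` J = a ` I \<and>
    (orthogonal_system E J b \<longleftrightarrow> orthogonal_system E I a) \<and> finite_sums E J b = finite_sums E I a"
proof -
  define C where "C x = {i \<in> I. a i = x}" for x
  define J where "J = {(x, n :: nat). x \<in> a ` I \<and> (finite (C x) \<longrightarrow> n < card (C x))}"
  define D where "D x = {j \<in> J. fst j = x}" for x
  have D: "D x = (if x \<in> a ` I then Pair x ` (if finite (C x) then {..<card (C x)} else UNIV) else {})"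
    for x by (auto simp: D_def J_def)
  have inj: "inj_on (Pair x) (A :: nat set)" for x :: 'a and A by (auto simp: inj_on_def)
  have CD: "finite (C x) = finite (D x) \<and> card (C x) = card (D x)" for x
  proof (cases "x \<in> a ` I")
    case True
    then show ?thesis by (auto simp: D card_image inj finite_image_iff)
  next
    case False
    then have "C x = {}" by (auto simp: C_def)
    with False show ?thesis by (simp add: D)
  qed
  have to_J: "\<exists>f. inj_on f F \<and> f ` F \<subseteq> J \<and> (\<forall>i\<in>F. fst (f i) = a i)" if "finite F" "F \<subseteq> I" for F
    using that
  proof (rule fibrewise_injection)
    fix x A assume "finite A" "A \<subseteq> {i \<in> I. a i = x}"
    then show "\<exists>g. inj_on g A \<and> g ` A \<subseteq> {j \<in> J. fst j = x}"
      using finite_subset_injection[of A "C x" "D x"] CD[of x] by (simp add: C_def D_def)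
  qed
  have to_I: "\<exists>f. inj_on f G \<and> f ` G \<subseteq> I \<and> (\<forall>j\<in>G. a (f j) = fst j)" if "finite G" "G \<subseteq> J" for G
    using that
  proof (rule fibrewise_injection)
    fix x A assume "finite A" "A \<subseteq> {j \<in> J. fst j = x}"
    then show "\<exists>g. inj_on g A \<and> g ` A \<subseteq> {i \<in> I. a i = x}"
      using finite_subset_injection[of A "D x" "C x"] CD[of x] by (simp add: C_def D_def)
  qed
  have fwd: "\<exists>G. finite G \<and> G \<subseteq> J \<and> (\<forall>s. has_finite_sum E fst G s \<longleftrightarrow> has_finite_sum E a F s)"
    if F: "finite F" "F \<subseteq> I" for F
  proof -
    obtain f where f: "inj_on f F" "f ` F \<subseteq> J" "\<forall>i\<in>F. fst (f i) = a i"
      using to_J[OF F] by (elim exE conjE)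
    then have "\<forall>s. has_finite_sum E fst (f ` F) s \<longleftrightarrow> has_finite_sum E a F s"
      by (simp add: has_finite_sum_reindex_iff)
    moreover have "finite (f ` F)" using F(1) by (rule finite_imageI)
    ultimately show ?thesis using f(2) by (intro exI[of _ "f ` F"] conjI)
  qed
  have bwd: "\<exists>F. finite F \<and> F \<subseteq> I \<and> (\<forall>s. has_finite_sum E a F s \<longleftrightarrow> has_finite_sum E fst G s)"
    if G: "finite G" "G \<subseteq> J" for G
  proof -
    obtain f where f: "inj_on f G" "f ` G \<subseteq> I" "\<forall>j\<in>G. a (f j) = fst j"
      using to_I[OF G] by (elim exE conjE)
    then have "\<forall>s. has_finite_sum E a (f ` G) s \<longleftrightarrow> has_finite_sum E fst G s"
      by (simp add: has_finite_sum_reindex_iff)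
    moreover have "finite (f ` G)" using G(1) by (rule finite_imageI)
    ultimately show ?thesis using f(2) by (intro exI[of _ "f ` G"] conjI)
  qed
  have img: "fst ` J = a ` I"
  proof
    show "fst ` J \<subseteq> a ` I" by (auto simp: J_def)
    show "a ` I \<subseteq> fst ` J"
    proof
      fix x assume x: "x \<in> a ` I"
      then have "C x \<noteq> {}" by (auto simp: C_def)
      then have "(x, 0) \<in> J" using x by (auto simp: J_def card_gt_0_iff)
      then show "x \<in> fst ` J" by force
    qed
  qed
  have car: "(\<forall>j\<in>J. fst j \<in> carrier E) \<longleftrightarrow> (\<forall>i\<in>I. a i \<in> carrier E)"
    using img ball_simps(9)[of fst J "\<lambda>y. y \<in> carrier E"] ball_simps(9)[of a I "\<lambda>y. y \<in> carrier E"]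
    by simp
  have "orthogonal_system E J fst \<longleftrightarrow> orthogonal_system E I a"
    proof -
    have "(\<forall>G. finite G \<and> G \<subseteq> J \<longrightarrow> (\<exists>s. has_finite_sum E fst G s)) \<longleftrightarrow>
        (\<forall>F. finite F \<and> F \<subseteq> I \<longrightarrow> (\<exists>s. has_finite_sum E a F s))"
    proof (intro iffI allI impI; elim conjE)
      fix F assume all: "\<forall>G. finite G \<and> G \<subseteq> J \<longrightarrow> (\<exists>s. has_finite_sum E fst G s)"
        and F: "finite F" "F \<subseteq> I"
      obtain G where G: "finite G" "G \<subseteq> J"
          "\<forall>s. has_finite_sum E fst G s \<longleftrightarrow> has_finite_sum E a F s"
        using fwd[OF F] by (elim exE conjE)
      from all[rule_format, OF conjI[OF G(1,2)]] obtain s where "has_finite_sum E fst G s" ..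
      then have "has_finite_sum E a F s" using G(3) by simp
      then show "\<exists>s. has_finite_sum E a F s" ..
    next
      fix G assume all: "\<forall>F. finite F \<and> F \<subseteq> I \<longrightarrow> (\<exists>s. has_finite_sum E a F s)"
        and G: "finite G" "G \<subseteq> J"
      obtain F where F: "finite F" "F \<subseteq> I"
          "\<forall>s. has_finite_sum E a F s \<longleftrightarrow> has_finite_sum E fst G s"
        using bwd[OF G] by (elim exE conjE)
      from all[rule_format, OF conjI[OF F(1,2)]] obtain s where "has_finite_sum E a F s" ..
      then have "has_finite_sum E fst G s" using F(3) by simp
      then show "\<exists>s. has_finite_sum E fst G s" ..
    qed
    then show ?thesis by (simp add: orthogonal_system_def car)
  qed
  moreover have "finite_sums E J fst = finite_sums E I a"
  proof (intro equalityI subsetI)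
    fix s assume "s \<in> finite_sums E J fst"
    then obtain G where G: "finite G" "G \<subseteq> J" "has_finite_sum E fst G s"
      by (auto simp: finite_sums_def)
    then show "s \<in> finite_sums E I a" using bwd[OF G(1,2)] by (auto simp: finite_sums_def)
  next
    fix s assume "s \<in> finite_sums E I a"
    then obtain F where F: "finite F" "F \<subseteq> I" "has_finite_sum E a F s"
      by (auto simp: finite_sums_def)
    then show "s \<in> finite_sums E J fst" using fwd[OF F(1,2)] by (auto simp: finite_sums_def)
  qed
  ultimately show ?thesis using img by blast
qed

lemma weakly_orthocomplete_any_index:
  fixes E :: "'a effect_structure" and I :: "'i set"
  assumes "weakly_orthocomplete E" "orthogonal_system E I a"
  shows "(\<exists>s. has_orthosum E I a s) \<or> \<not> (\<exists>u. is_minimal_upper_bound E (finite_sums E I a) u)"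
proof -
  obtain J :: "('a \<times> nat) set" and b where "orthogonal_system E J b \<longleftrightarrow> orthogonal_system E I a"
      "finite_sums E J b = finite_sums E I a"
    using exists_system_same_finite_sums[of a I E] by blast
  moreover from this have "has_orthosum E J b = has_orthosum E I a"
    by (intro ext) (simp add: has_orthosum_def)
  ultimately show ?thesis
    using assms(1)[unfolded weakly_orthocomplete_def, rule_format, of J b] assms(2)
    by simp
qed

lemma orthoatomistic_any_index:
  fixes E :: "'a effect_structure"
  assumes "\<And>x. \<lbrakk>x \<in> carrier E; x \<noteq> bottom E\<rbrakk>
    \<Longrightarrow> \<exists>(I :: 'i set) a. (\<forall>i\<in>I. is_atom E (a i)) \<and> has_orthosum E I a x"
  shows "orthoatomistic E"
  unfolding orthoatomistic_def
proof (intro ballI impI)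
  fix x assume "x \<in> carrier E" "x \<noteq> bottom E"
  then obtain I :: "'i set" and a where I: "\<forall>i\<in>I. is_atom E (a i)" "has_orthosum E I a x"
    using assms by blast
  obtain J :: "('a \<times> nat) set" and b where J: "b ` J = a ` I"
      "orthogonal_system E J b \<longleftrightarrow> orthogonal_system E I a" "finite_sums E J b = finite_sums E I a"
    using exists_system_same_finite_sums[of a I E] by blast
  have "\<forall>j\<in>J. is_atom E (b j)" 
    using I(1) J(1) ball_simps(9)[of b J "is_atom E"] ball_simps(9)[of a I "is_atom E"] by simp
  moreover have "has_orthosum E J b x" using I(2) J(2,3) by (simp add: has_orthosum_def)
  ultimately show "\<exists>(I :: ('a \<times> nat) set) a. (\<forall>i\<in>I. is_atom E (a i)) \<and> has_orthosum E I a x"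
    by blast
qed

end

(* Among the orthogonal systems of atoms whose finite sums lie below x, choose a maximal one.
   Then x is a minimal upper bound of its finite sums: if y < x were another upper bound, an
   atom p below the difference of x and y could be adjoined to the system.  By the Archimedean
   property p occurs only finitely often, so a fresh copy of p is available and the enlarged
   system contradicts maximality.  Weak orthocompleteness then provides the supremum of the
   finite sums, which is x by minimality. *)
theory Submission imports Defs begin

section \<open>Zero and the order in an effect algebra\<close>

context effect_algebra
begin

text \<open>The orthosupplement \<open>z\<close> of the unit makes \<open>z \<oplus> 1\<close>
  defined by commutativity, so the zero-one law forces \<open>z = 0\<close>.\<close>

lemma unit_oplus_bottom: "oplus E (unit E) (bottom E) = Some (unit E)"
proof -
  obtain z where z: "z \<in> carrier E" "oplus E (unit E) z = Some (unit E)"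
    using orthosupplement[OF unit_closed] by blast
  then have "oplus E z (unit E) = Some (unit E)"
    using oplus_comm unit_closed by blast
  then have "z = bottom E" using zero_one_law z(1) by simp
  with z show ?thesis by simp
qed

text \<open>Regrouping \<open>(x' \<oplus> x) \<oplus> 0 = 1\<close> as
  \<open>x' \<oplus> (x \<oplus> 0) = 1\<close> shows that \<open>x\<close> and
  \<open>x \<oplus> 0\<close> are both orthosupplements of \<open>x'\<close>, hence equal.\<close>

lemma oplus_bottom:
  assumes "x \<in> carrier E"
  shows "oplus E x (bottom E) = Some x"
proof -
  obtain x' where x': "x' \<in> carrier E" "oplus E x x' = Some (unit E)"
    using orthosupplement[OF assms] by blast
  then have sup: "oplus E x' x = Some (unit E)" using oplus_comm assms by blast
  then obtain f where f: "oplus E x (bottom E) = Some f" "oplus E x' f = Some (unit E)"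
    using oplus_assoc[OF x'(1) assms bottom_closed] unit_oplus_bottom by blast
  then have "f = x"
    using orthosupplement[OF x'(1)] sup oplus_closed assms bottom_closed by blast
  with f show ?thesis by simp
qed

lemma bottom_le: "x \<in> carrier E \<Longrightarrow> ea_le E (bottom E) x"
  unfolding ea_le_def using oplus_bottom oplus_comm bottom_closed by blast

lemma oplus_swap:
  assumes "a \<in> carrier E" "b \<in> carrier E" "c \<in> carrier E"
    and "oplus E a b = Some d" "oplus E d c = Some e"
  obtains f where "oplus E a c = Some f" "oplus E f b = Some e"
proof -
  have "oplus E b a = Some d" using assms oplus_comm by blast
  then obtain f where f: "oplus E a c = Some f" "oplus E b f = Some e"
    using oplus_assoc assms by blast
  then have "oplus E f b = Some e" using assms oplus_comm oplus_closed by blast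
  with f(1) show thesis by (rule that)
qed

text \<open>With \<open>y = s \<oplus> c\<close> and \<open>z = p \<oplus> d\<close>, the sum
  \<open>x = (s \<oplus> c) \<oplus> (p \<oplus> d)\<close> rearranges to
  \<open>(s \<oplus> p) \<oplus> (d \<oplus> c)\<close>. Each regrouping also yields definedness of
  the new partial sum.\<close>

lemma oplus_le_if_le_difference:
  assumes "s \<in> carrier E" "y \<in> carrier E" "z \<in> carrier E" "p \<in> carrier E"
    and "ea_le E s y" "oplus E y z = Some x" "ea_le E p z"
  obtains t where "oplus E s p = Some t" "ea_le E t x"
proof -
  obtain c where c: "c \<in> carrier E" "oplus E s c = Some y"
    using assms(5) unfolding ea_le_def by blast
  obtain d where d: "d \<in> carrier E" "oplus E p d = Some z"
    using assms(7) unfolding ea_le_def by blast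
  obtain w where w: "oplus E s z = Some w" "oplus E w c = Some x"
    using oplus_swap[OF assms(1) c(1) assms(3) c(2) assms(6)] by blast
  have "oplus E z s = Some w" using w(1) oplus_comm assms by blast
  then obtain t where t: "oplus E p s = Some t" "oplus E t d = Some w"
    using oplus_swap[OF assms(4) d(1) assms(1) d(2)] by blast
  have st: "oplus E s p = Some t" and tE: "t \<in> carrier E"
    using t(1) oplus_comm oplus_closed assms(1,4) by blast+
  obtain g where "oplus E d c = Some g" "oplus E t g = Some x"
    using oplus_assoc[OF tE d(1) c(1) t(2) w(2)] by blast
  then have "ea_le E t x" unfolding ea_le_def using oplus_closed c(1) d(1) by blast
  with st show thesis by (rule that)
qed

section \<open>Finite sums\<close>

lemma has_finite_sum_closed:
  assumes "has_finite_sum E a F s" "\<And>i. i \<in> F \<Longrightarrow> a i \<in> carrier E"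
  shows "s \<in> carrier E"
  using assms
proof (induction rule: has_finite_sum.induct)
  case empty
  show ?case by (rule bottom_closed)
next
  case (insert F s i t)
  then have "s \<in> carrier E" "a i \<in> carrier E" by auto
  then show ?case using insert.hyps(3) by (rule oplus_closed)
qed

text \<open>The inductive rule exposes only the index inserted last. Moving a summand past the later
  ones with \<open>oplus_swap\<close> lets any index of \<open>F\<close> take that place.\<close>

lemma has_finite_sum_remove:
  assumes "has_finite_sum E a F t" "i \<in> F" "\<And>j. j \<in> F \<Longrightarrow> a j \<in> carrier E"
  shows "\<exists>s. has_finite_sum E a (F - {i}) s \<and> oplus E s (a i) = Some t"
  using assms
proof (induction rule: has_finite_sum.induct)
  case empty
  then show ?case by simp
next
  case (insert F s j t)
  show ?case
  proof (cases "i = j")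
    case True
    with insert.hyps show ?thesis by auto
  next
    case False
    have car: "a k \<in> carrier E" if "k \<in> insert j F" for k using that by (rule insert.prems)
    from False insert.prems(1) have iF: "i \<in> F" by simp
    then obtain r where r: "has_finite_sum E a (F - {i}) r" "oplus E r (a i) = Some s"
      using insert.IH car by blast
    have "r \<in> carrier E" using r(1) by (rule has_finite_sum_closed) (simp add: car)
    then obtain u where u: "oplus E r (a j) = Some u" "oplus E u (a i) = Some t"
      using oplus_swap[OF _ car car r(2) insert.hyps(3)] iF by blast
    have "has_finite_sum E a (insert j (F - {i})) u"
      using r(1) u(1) insert.hyps(2) by (intro has_finite_sum.insert) auto
    moreover have "insert j (F - {i}) = insert j F - {i}" using False by auto
    ultimately show ?thesis using u(2) by auto
  qed
qed

end

section \<open>Repeated elements in Archimedean effect algebras\<close>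

lemma has_finite_sum_constant:
  assumes "has_finite_sum E a F s" "\<And>i. i \<in> F \<Longrightarrow> a i = p"
  shows "finite F \<and> multiple E (card F) p = Some s"
  using assms by (induction rule: has_finite_sum.induct) auto

text \<open>Infinitely many indices with value \<open>p\<close> would contain \<open>k\<close> of
  them for every \<open>k\<close>, so every multiple \<open>kp\<close> would be defined and the
  isotropic index of \<open>p\<close> infinite.\<close>

lemma archimedean_finite_repetition:
  assumes "archimedean E" "orthogonal_system E I a" "p \<in> carrier E" "p \<noteq> bottom E"
  shows "finite {i \<in> I. a i = p}"
proof (rule ccontr)
  assume inf: "infinite {i \<in> I. a i = p}"
  have "enat k \<le> isotropic_index E p" for k
  proof -
    obtain F where F: "finite F" "card F = k" "F \<subseteq> {i \<in> I. a i = p}"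
      using infinite_arbitrarily_large[OF inf] by blast
    then obtain s where "has_finite_sum E a F s"
      using assms(2) unfolding orthogonal_system_def by blast
    then have "multiple E k p = Some s"
      using has_finite_sum_constant[of E a F s p] F by auto
    then show ?thesis unfolding isotropic_index_def by (intro SUP_upper) simp
  qed
  moreover have "isotropic_index E p < \<infinity>"
    using assms unfolding archimedean_def by blast
  moreover from this obtain k where "isotropic_index E p = enat k"
    by (auto elim: less_infinityE)
  ultimately show False
    using Suc_n_not_le_n enat_ord_simps(1) by metis
qed

section \<open>Systems of atoms below an element\<close>

text \<open>An index \<open>(p, n)\<close> stands for the copy of \<open>p\<close> numbered
  \<open>n\<close>. With the family fixed as \<open>fst\<close>, a system is just a set of pairs, so
  extending it is set inclusion and Zorn's lemma for sets applies.\<close>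

definition atom_system_below :: "'a effect_structure \<Rightarrow> 'a \<Rightarrow> ('a \<times> nat) set \<Rightarrow> bool" where
  "atom_system_below E x I \<longleftrightarrow>
     (\<forall>i\<in>I. is_atom E (fst i)) \<and> orthogonal_system E I fst \<and>
     is_upper_bound E (finite_sums E I fst) x"

text \<open>Orthogonality and the bound by \<open>x\<close> concern only finite index sets, and a
  finite subset of the union of a nonempty chain already lies in one member.\<close>

lemma atom_system_below_Union:
  assumes chain: "subset.chain {I. atom_system_below E x I} C" and "C \<noteq> {}"
  shows "atom_system_below E x (\<Union>C)"
proof -
  have mem: "atom_system_below E x I" if "I \<in> C" for I
    using chain that unfolding subset.chain_def by blast
  have fin: "\<exists>I\<in>C. F \<subseteq> I" if "finite F" "F \<subseteq> \<Union>C" for F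
    using finite_subset_Union_chain[OF that assms(2) chain] by blast
  have "\<forall>i\<in>\<Union>C. is_atom E (fst i)" using mem unfolding atom_system_below_def by blast
  moreover have "orthogonal_system E (\<Union>C) fst"
    using mem fin unfolding atom_system_below_def orthogonal_system_def by (meson UnionE)
  moreover have "is_upper_bound E (finite_sums E (\<Union>C) fst) x"
    unfolding is_upper_bound_def
  proof (intro conjI ballI)
    show "x \<in> carrier E"
      using mem assms(2) unfolding atom_system_below_def is_upper_bound_def by blast
    fix s assume "s \<in> finite_sums E (\<Union>C) fst"
    then obtain F where F: "finite F" "F \<subseteq> \<Union>C" "has_finite_sum E fst F s"
      unfolding finite_sums_def by blast
    then obtain I where "I \<in> C" "F \<subseteq> I" using fin by blast
    with F show "ea_le E s x"
      using mem unfolding atom_system_below_def is_upper_bound_def finite_sums_def by blast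
  qed
  ultimately show ?thesis unfolding atom_system_below_def by blast
qed

context effect_algebra
begin

lemma atom_system_below_empty:
  assumes "x \<in> carrier E"
  shows "atom_system_below E x {}"
proof -
  have "has_finite_sum E fst {} s \<Longrightarrow> s = bottom E" for s
    by (auto elim: has_finite_sum.cases)
  then show ?thesis
    using assms bottom_le has_finite_sum.empty[of E]
    unfolding atom_system_below_def orthogonal_system_def is_upper_bound_def finite_sums_def
    by auto
qed

lemma maximal_atom_system_below:
  assumes "x \<in> carrier E"
  obtains M where "atom_system_below E x M"
    and "\<And>I. atom_system_below E x I \<Longrightarrow> M \<subseteq> I \<Longrightarrow> I = M"
proof -
  have "\<exists>M\<in>{I. atom_system_below E x I}. \<forall>I\<in>{I. atom_system_below E x I}. M \<subseteq> I \<longrightarrow> I = M"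
  proof (rule subset_Zorn_nonempty)
    show "{I. atom_system_below E x I} \<noteq> {}" using atom_system_below_empty[OF assms] by blast
    show "\<Union>C \<in> {I. atom_system_below E x I}"
      if "C \<noteq> {}" "subset.chain {I. atom_system_below E x I} C" for C
      using atom_system_below_Union[OF that(2,1)] by simp
  qed
  then show thesis using that by blast
qed

text \<open>A finite sum over the enlarged system either avoids \<open>(p, n)\<close> or has the
  form \<open>s \<oplus> p\<close> with \<open>s\<close> a finite sum over \<open>I\<close>. The
  bound \<open>s \<le> y\<close> keeps the difference \<open>z\<close> free to accommodate
  \<open>p\<close>.\<close>

lemma atom_system_below_insert:
  assumes I: "atom_system_below E x I"
    and y: "is_upper_bound E (finite_sums E I fst) y"
    and z: "z \<in> carrier E" "oplus E y z = Some x"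
    and p: "is_atom E p" "ea_le E p z"
    and n: "(p, n) \<notin> I"
  shows "atom_system_below E x (insert (p, n) I)"
proof -
  let ?J = "insert (p, n) I"
  have atoms: "\<forall>i\<in>?J. is_atom E (fst i)"
    using I p unfolding atom_system_below_def by auto
  then have car: "fst i \<in> carrier E" if "i \<in> ?J" for i
    using that unfolding is_atom_def by blast
  have yE: "y \<in> carrier E" and xE: "x \<in> carrier E"
    using I y unfolding atom_system_below_def is_upper_bound_def by blast+
  have add: "\<exists>t. oplus E s p = Some t \<and> ea_le E t x"
    if "has_finite_sum E fst F s" "finite F" "F \<subseteq> I" for F s
  proof -
    have "s \<in> carrier E" using that(1) by (rule has_finite_sum_closed) (use that car in auto)
    moreover have "ea_le E s y"
      using y that unfolding is_upper_bound_def finite_sums_def by blast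
    ultimately show ?thesis
      using oplus_le_if_le_difference[OF _ yE z(1) _ _ z(2) p(2)] p(1) unfolding is_atom_def
      by blast
  qed
  have sum: "\<exists>s. has_finite_sum E fst F s" if "finite F" "F \<subseteq> I" for F
    using I that unfolding atom_system_below_def orthogonal_system_def by blast
  have "\<exists>t. has_finite_sum E fst F t" if F: "finite F" "F \<subseteq> ?J" for F
  proof (cases "(p, n) \<in> F")
    case True
    have F': "finite (F - {(p, n)})" "F - {(p, n)} \<subseteq> I" using F by auto
    obtain s where s: "has_finite_sum E fst (F - {(p, n)}) s" using sum F' by blast
    obtain t where "oplus E s p = Some t" using add[OF s F'] by blast
    then have "has_finite_sum E fst (insert (p, n) (F - {(p, n)})) t"
      using s by (intro has_finite_sum.insert) auto
    then show ?thesis using True by (auto simp: insert_absorb)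
  next
    case False
    with F have "F \<subseteq> I" by blast
    with F(1) show ?thesis by (rule sum)
  qed
  then have "orthogonal_system E ?J fst"
    using car unfolding orthogonal_system_def by blast
  moreover have "ea_le E t x" if "t \<in> finite_sums E ?J fst" for t
  proof -
    obtain F where F: "finite F" "F \<subseteq> ?J" "has_finite_sum E fst F t"
      using \<open>t \<in> finite_sums E ?J fst\<close> unfolding finite_sums_def by blast
    show ?thesis
    proof (cases "(p, n) \<in> F")
      case True
      \<comment> \<open>The given derivation of \<open>t\<close> may have inserted
        \<open>(p, n)\<close> at any stage; it is rearranged so that \<open>p\<close> is added last
        and \<open>add\<close> applies.\<close>
      obtain s where s: "has_finite_sum E fst (F - {(p, n)}) s" "oplus E s p = Some t"
        using has_finite_sum_remove[OF F(3) True] F(2) car by auto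
      have "finite (F - {(p, n)})" "F - {(p, n)} \<subseteq> I" using F by auto
      with s show ?thesis using add[OF s(1)] by auto
    next
      case False
      with F have "F \<subseteq> I" by blast
      with F show ?thesis
        using I unfolding atom_system_below_def is_upper_bound_def finite_sums_def by blast
    qed
  qed
  ultimately show ?thesis
    using atoms xE unfolding atom_system_below_def is_upper_bound_def by blast
qed

section \<open>Maximal systems and minimal upper bounds\<close>

lemma maximal_atom_system_minimal_upper_bound:
  assumes "archimedean E" "atomic E"
    and M: "atom_system_below E x M"
    and max: "\<And>I. atom_system_below E x I \<Longrightarrow> M \<subseteq> I \<Longrightarrow> I = M"
  shows "is_minimal_upper_bound E (finite_sums E M fst) x"
  unfolding is_minimal_upper_bound_def
proof (intro conjI allI impI; (elim conjE)?)
  show "is_upper_bound E (finite_sums E M fst) x"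
    using M unfolding atom_system_below_def by blast
next
  fix y assume y: "is_upper_bound E (finite_sums E M fst) y" and "ea_le E y x"
  then obtain z where z: "z \<in> carrier E" "oplus E y z = Some x"
    unfolding ea_le_def by blast
  have "z = bottom E"
  proof (rule ccontr)
    assume "z \<noteq> bottom E"
    then obtain p where p: "is_atom E p" "ea_le E p z"
      using assms(2) z(1) unfolding atomic_def by blast
    have "finite {i \<in> M. fst i = p}"
      using archimedean_finite_repetition[OF assms(1)] M p(1)
      unfolding atom_system_below_def is_atom_def by blast
    then have "finite (snd ` {i \<in> M. fst i = p})" by (rule finite_imageI)
    then obtain n where "n \<notin> snd ` {i \<in> M. fst i = p}"
      using ex_new_if_finite infinite_UNIV_nat by blast
    then have n: "(p, n) \<notin> M" by force
    have "insert (p, n) M = M"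
      using atom_system_below_insert[OF M y z p n] by (rule max) blast
    with n show False by blast
  qed
  then show "y = x"
    using z(2) oplus_bottom y unfolding is_upper_bound_def by simp
qed

end

theorem theorem3p7:
  fixes E :: "'a effect_structure"
  assumes "effect_algebra E"
    and "weakly_orthocomplete E"
    and "archimedean E"
    and "atomic E"
  shows "orthoatomistic E"
proof -
  interpret effect_algebra E by fact
  show ?thesis unfolding orthoatomistic_def
  proof (intro ballI impI)
    fix x assume "x \<in> carrier E"
    then obtain M where M: "atom_system_below E x M"
      and max: "\<And>I. atom_system_below E x I \<Longrightarrow> M \<subseteq> I \<Longrightarrow> I = M"
      using maximal_atom_system_below by blast
    have min: "is_minimal_upper_bound E (finite_sums E M fst) x"
      using assms(3,4) M max by (rule maximal_atom_system_minimal_upper_bound)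
    have "orthogonal_system E M fst" using M unfolding atom_system_below_def by blast
    \<comment> \<open>The minimal upper bound \<open>x\<close> rules out the second alternative of
      weak orthocompleteness.\<close>
    then obtain s where s: "has_orthosum E M fst s"
      using assms(2) min unfolding weakly_orthocomplete_def by blast
    \<comment> \<open>The supremum \<open>s\<close> lies below the upper bound \<open>x\<close> and
      is itself an upper bound, so minimality of \<open>x\<close> gives equality.\<close>
    then have "s = x"
      using min unfolding has_orthosum_def is_supremum_def is_minimal_upper_bound_def by blast
    with s show "\<exists>(I :: ('a \<times> nat) set) a. (\<forall>i\<in>I. is_atom E (a i)) \<and> has_orthosum E I a x"
      using M unfolding atom_system_below_def by blast
  qed
qed

end
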